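(* Let $q\in(0,1)$ and let $r=\min\{q,\tfrac12\}$. For every real $\epsilon>0$ and every integer $$k\ \ge\ e^{\frac{8(r-\epsilon)}{\epsilon^3}}+e^{\frac{4\ln(1/12)}{\ln(1-r)}},$$ the performance ratio of the recruiting game $G_{k,q}(1,1)$ is at least $$\frac{1+2q\,(r-3\epsilon-\epsilon^2)}{1+q}.$$
   Context: Recruiting game. For an integer $k\ge 1$, a real $q\in(0,1)$ and positive integers $x_1,x_2$, the game $G_{k,q}(x_1,x_2)$ (also written $G_k(x_1,x_2)$) is played by two players over $k$ rounds; player $i$ has initial reputation $x_i$. In each round there are two candidates, the stronger one of quality $1$ and the weaker one of quality $q$. Knowing the outcomes of all previous rounds, the players simultaneously each choose one candidate to make an offer to. If they choose different candidates, each player hires the candidate it chose. If they choose the same candidate, player 1 hires it with probability $\frac{x_1}{x_1+x_2}$ and player 2 hires it with probability $\frac{x_2}{x_1+x_2}$, where $x_1,x_2$ are the current reputations; the player who loses hires no one in that round. A player's payoff in a round is the quality of the candidate it hires ($0$ if none). Its reputation increases by $1$ if it hired the stronger candidate and is unchanged otherwise. A player's utility is its total expected payoff over the $k$ rounds. Canonical strategies. At any point the higher player is the one with larger current reputation (player 1 in case of equality) and the other is the lower player. The strategies $s_k(x_1,x_2)$ are defined by backward induction: in every round the higher player makes an offer to the stronger candidate, and the lower player chooses the candidate maximizing its own expected total utility from the current and all later rounds, given that the later rounds are played according to these strategies; if indifferent, the lower player chooses the weaker candidate. Let $u_i(s_k(x_1,x_2))$ be player $i$'s expected utility under these strategies,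 and $u(s_k(x_1,x_2))=u_1(s_k(x_1,x_2))+u_2(s_k(x_1,x_2))$ the expected social welfare. Performance ratio. The maximum possible social welfare is $k(1+q)$, and the performance ratio of $G_{k,q}(x_1,x_2)$ is $\dfrac{u(s_k(x_1,x_2))}{k(1+q)}$. *)

theory Defs
  imports "HOL-Probability.Probability"
begin

datatype player = P1 | P2

datatype candidate = Strong | Weak

text \<open>The outcome of a round records whom each player hires (\<open>None\<close>: no one).\<close>

type_synonym outcome = "player \<Rightarrow> candidate option"

text \<open>Histories list the outcomes of the previous rounds, the earliest round first.  A strategy
  profile tells each player, for every history, whom to make an offer to.\<close>

type_synonym history = "outcome list"
type_synonym profile = "history \<Rightarrow> player \<Rightarrow> candidate"
type_synonym reputation = "player \<Rightarrow> nat"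

fun quality :: "real \<Rightarrow> candidate \<Rightarrow> real" where
  "quality q Strong = 1"
| "quality q Weak = q"

fun payoff :: "real \<Rightarrow> candidate option \<Rightarrow> real" where
  "payoff q None = 0"
| "payoff q (Some c) = quality q c"

definition contest_winner :: "reputation \<Rightarrow> player pmf" where
  "contest_winner x =
     map_pmf (\<lambda>b. if b then P1 else P2) (bernoulli_pmf (real (x P1) / (real (x P1) + real (x P2))))"

definition round_outcome :: "reputation \<Rightarrow> (player \<Rightarrow> candidate) \<Rightarrow> outcome pmf" where
  "round_outcome x a =
     (if a P1 = a P2
      then map_pmf (\<lambda>w i. if i = w then Some (a i) else None) (contest_winner x)
      else return_pmf (\<lambda>i. Some (a i)))"

definition update_reputation :: "reputation \<Rightarrow> outcome \<Rightarrow> reputation" where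
  "update_reputation x r = (\<lambda>i. x i + (if r i = Some Strong then 1 else 0))"

text \<open>The distribution of the complete history when a profile is played for a given number of
  rounds, starting from given reputations.\<close>

primrec play :: "nat \<Rightarrow> reputation \<Rightarrow> profile \<Rightarrow> history pmf" where
  "play 0 x s = return_pmf []"
| "play (Suc k) x s =
     bind_pmf (round_outcome x (s []))
       (\<lambda>r. map_pmf (Cons r) (play k (update_reputation x r) (\<lambda>h. s (r # h))))"

definition utility :: "real \<Rightarrow> player \<Rightarrow> nat \<Rightarrow> reputation \<Rightarrow> profile \<Rightarrow> real" where
  "utility q i k x s =
     measure_pmf.expectation (play k x s) (\<lambda>h. \<Sum>r\<leftarrow>h. payoff q (r i))"

definition higher_player :: "reputation \<Rightarrow> player" where
  "higher_player x = (if x P1 \<ge> x P2 then P1 else P2)"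

definition lower_player :: "reputation \<Rightarrow> player" where
  "lower_player x = (if x P1 \<ge> x P2 then P2 else P1)"

definition first_round_then ::
    "(player \<Rightarrow> candidate) \<Rightarrow> (outcome \<Rightarrow> profile) \<Rightarrow> profile" where
  "first_round_then a t = (\<lambda>h. case h of [] \<Rightarrow> a | r # h' \<Rightarrow> t r h')"

text \<open>The canonical profile of the game with \<open>k\<close> rounds and initial reputations \<open>x\<close>.  Its value
  for \<open>k = 0\<close>, and on histories of length at least \<open>k\<close>, never influences play.\<close>

primrec canonical :: "real \<Rightarrow> nat \<Rightarrow> reputation \<Rightarrow> profile" where
  "canonical q 0 x = (\<lambda>h i. Weak)"
| "canonical q (Suc k) x =
     (let s = (\<lambda>c. first_round_then
                     (\<lambda>i. if i = higher_player x then Strong else c)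
                     (\<lambda>r. canonical q k (update_reputation x r)));
          v = (\<lambda>c. utility q (lower_player x) (Suc k) x (s c))
      in if v Strong > v Weak then s Strong else s Weak)"

definition initial_reputation :: "nat \<Rightarrow> nat \<Rightarrow> reputation" where
  "initial_reputation x1 x2 = (\<lambda>i. case i of P1 \<Rightarrow> x1 | P2 \<Rightarrow> x2)"

definition social_welfare :: "real \<Rightarrow> nat \<Rightarrow> reputation \<Rightarrow> profile \<Rightarrow> real" where
  "social_welfare q k x s = utility q P1 k x s + utility q P2 k x s"

definition performance_ratio :: "real \<Rightarrow> nat \<Rightarrow> nat \<Rightarrow> nat \<Rightarrow> real" where
  "performance_ratio q k x1 x2 =
     (let x = initial_reputation x1 x2
      in social_welfare q k x (canonical q k x) / (real k * (1 + q)))"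

end

theory Submission imports Defs begin

text \<open>The stronger candidate is hired in every round, so the total reputation \<open>n\<close> grows by one
  per round, and the welfare of a round is \<open>1 + q\<close> or \<open>1\<close> according to whether the lower player
  stays away from the stronger candidate or competes.

  A contest makes the lower player's share of the reputation a martingale with increments at most
  \<open>1 / (n + 1)\<close>, and staying away decreases the share.  Hence, if the share is at most \<open>r - \<epsilon>\<close>
  when \<open>n \<ge> m\<close>, where \<open>m\<close> is about \<open>8 ln k / \<epsilon>\<^sup>2\<close>, it ever reaches \<open>r\<close> with
  probability at most \<open>k\<^sup>-\<^sup>2\<close>, even after winning the current contest.  An additional unit of
  reputation is then worth at most \<open>\<epsilon>\<close>, which does not pay for the loss of at least \<open>\<epsilon>\<close> that competing
  incurs now: below \<open>r - \<epsilon>\<close> the lower player never competes again.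

  While both players compete, player 1's reputation follows a Polya urn, which, started from
  \<open>(1, 1)\<close>, is uniformly distributed when \<open>n = m\<close>, so that the smaller share is below
  \<open>r - \<epsilon>\<close> with probability about \<open>2 (r - \<epsilon>)\<close>.  In that case all but the first \<open>m\<close> of
  the \<open>k\<close> rounds have full welfare, and \<open>m \<le> \<epsilon> k\<close>.\<close>

section \<open>Reputations, shares and promotions\<close>

lemma higher_neq_lower: "higher_player x \<noteq> lower_player x"
  by (simp add: higher_player_def lower_player_def)

definition total :: "reputation \<Rightarrow> nat" where
  "total x = x P1 + x P2"

definition promote :: "player \<Rightarrow> reputation \<Rightarrow> reputation" where
  "promote w x = x(w := Suc (x w))"

definition share :: "player \<Rightarrow> reputation \<Rightarrow> real" where
  "share i x = real (x i) / real (total x)"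

lemma total_promote [simp]: "total (promote w x) = Suc (total x)"
  by (cases w) (simp_all add: total_def promote_def)

lemma total_eq_higher_lower: "total x = x (higher_player x) + x (lower_player x)"
  by (simp add: total_def higher_player_def lower_player_def)

lemma lower_player_promote_higher [simp]:
  "lower_player (promote (higher_player x) x) = lower_player x"
  by (auto simp: lower_player_def higher_player_def promote_def)

lemma lower_player_eqI: "2 * x i < total x \<Longrightarrow> lower_player x = i"
  by (cases i) (auto simp: lower_player_def total_def)

lemma lower_le_higher: "x (lower_player x) \<le> x (higher_player x)"
  by (auto simp: lower_player_def higher_player_def)

lemma share_nonneg: "0 \<le> share i x"
  by (simp add: share_def)

lemma share_le_1: "share i x \<le> 1"
  by (cases i) (auto simp: share_def total_def divide_le_eq_1)

lemma share_add: "total x > 0 \<Longrightarrow> share P1 x + share P2 x = 1"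
  by (simp add: share_def total_def flip: add_divide_distrib) (simp flip: of_nat_add)

lemma share_promote_self: "share w (promote w x) = (real (x w) + 1) / (real (total x) + 1)"
  by (simp add: share_def) (simp add: promote_def add.commute)

lemma share_promote_other:
  "w \<noteq> i \<Longrightarrow> share i (promote w x) = real (x i) / (real (total x) + 1)"
  by (simp add: share_def) (simp add: promote_def add.commute)

text \<open>The higher player always chooses the stronger candidate, so \<open>contested\<close> and
  \<open>uncontested\<close> cover all outcomes of canonical play.\<close>

definition contested :: "player \<Rightarrow> outcome" where
  "contested w = (\<lambda>i. if i = w then Some Strong else None)"

definition uncontested :: "player \<Rightarrow> outcome" where
  "uncontested h = (\<lambda>i. Some (if i = h then Strong else Weak))"

lemma update_contested [simp]: "update_reputation x (contested w) = promote w x"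
  by (auto simp: update_reputation_def contested_def promote_def)

lemma update_uncontested [simp]: "update_reputation x (uncontested w) = promote w x"
  by (auto simp: update_reputation_def uncontested_def promote_def)

section \<open>Utilities as expectations over finitely many histories\<close>

lemma finite_set_round_outcome: "finite (set_pmf (round_outcome x a))"
  by (auto simp: round_outcome_def contest_winner_def)

lemma finite_set_play: "finite (set_pmf (play k x s))"
  by (induction k arbitrary: x s) (auto intro: finite_set_round_outcome)

lemma utility_0 [simp]: "utility q i 0 x s = 0"
  by (simp add: utility_def)

lemma utility_Suc:
  "utility q i (Suc k) x s =
     measure_pmf.expectation (round_outcome x (s []))
       (\<lambda>r. payoff q (r i) + utility q i k (update_reputation x r) (\<lambda>h. s (r # h)))"
proof -
  have "utility q i (Suc k) x s =
     measure_pmf.expectation (round_outcome x (s []))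
       (\<lambda>r. measure_pmf.expectation (play k (update_reputation x r) (\<lambda>h. s (r # h)))
          (\<lambda>h. payoff q (r i) + (\<Sum>r\<leftarrow>h. payoff q (r i))))"
    unfolding utility_def play.simps
    by (subst pmf_expectation_bind[where A = "set_pmf (round_outcome x (s []))"])
       (auto simp: finite_set_round_outcome finite_set_play
          integral_measure_pmf_real[where A = "set_pmf (round_outcome x (s []))"] mult.commute
          intro!: sum.cong)
  also have "\<dots> = measure_pmf.expectation (round_outcome x (s []))
       (\<lambda>r. payoff q (r i) + utility q i k (update_reputation x r) (\<lambda>h. s (r # h)))"
    unfolding utility_def
    by (subst Bochner_Integration.integral_add)
       (auto simp: integrable_measure_pmf_finite finite_set_play)
  finally show ?thesis .
qed

lemma payoff_le_1: "q \<le> 1 \<Longrightarrow> payoff q c \<le> 1"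
  by (cases c; cases "the c") auto

lemma utility_le: "q \<le> 1 \<Longrightarrow> utility q i k x s \<le> real k"
proof (induction k arbitrary: x s)
  case (Suc k)
  show ?case
    unfolding utility_Suc
    using Suc payoff_le_1
    by (intro measure_pmf.integral_le_const integrable_measure_pmf_finite finite_set_round_outcome)
       (auto intro!: AE_pmfI add_mono)
qed simp

lemma expectation_round_contested:
  assumes "total x > 0"
  shows "measure_pmf.expectation (round_outcome x (\<lambda>i. Strong)) f =
    share P1 x * f (contested P1) + share P2 x * f (contested P2)"
proof -
  have "share P2 x = 1 - share P1 x" using share_add[OF assms] by simp
  moreover have "real (x P1) / (real (x P1) + real (x P2)) = share P1 x"
    by (simp add: share_def total_def)
  ultimately show ?thesis
    using share_nonneg[of P1 x] share_le_1[of P1 x]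
    by (simp add: round_outcome_def contest_winner_def contested_def map_pmf_comp mult.commute)
qed

lemma expectation_round_uncontested:
  fixes f :: "outcome \<Rightarrow> real"
  shows "measure_pmf.expectation (round_outcome x (\<lambda>i. if i = h then Strong else Weak)) f =
     f (uncontested h)"
  by (cases h) (auto simp: round_outcome_def uncontested_def)

section \<open>Recursions for values and welfare under the canonical profile\<close>

abbreviation canonical_value :: "real \<Rightarrow> player \<Rightarrow> nat \<Rightarrow> reputation \<Rightarrow> real" where
  "canonical_value q i k x \<equiv> utility q i k x (canonical q k x)"

abbreviation welfare :: "real \<Rightarrow> nat \<Rightarrow> reputation \<Rightarrow> real" where
  "welfare q k x \<equiv> social_welfare q k x (canonical q k x)"

text \<open>This concerns the first of \<open>Suc k\<close> rounds. The strict inequality encodes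
  that an indifferent lower player chooses the weaker candidate.\<close>

definition competes :: "real \<Rightarrow> nat \<Rightarrow> reputation \<Rightarrow> bool" where
  "competes q k x \<longleftrightarrow>
     (let l = lower_player x; h = higher_player x in
        q + canonical_value q l k (promote h x) <
        share l x * (1 + canonical_value q l k (promote l x)) +
        share h x * canonical_value q l k (promote h x))"

lemma utility_first_round_then:
  "utility q i (Suc k) x (first_round_then a (\<lambda>r. canonical q k (update_reputation x r))) =
     measure_pmf.expectation (round_outcome x a)
       (\<lambda>r. payoff q (r i) + canonical_value q i k (update_reputation x r))"
  by (simp add: utility_Suc first_round_then_def)

lemma expectation_round_contested_higher_lower:
  assumes "total x > 0"
  shows "measure_pmf.expectation (round_outcome x (\<lambda>i. Strong)) f =
    share (higher_player x) x * f (contested (higher_player x)) +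
    share (lower_player x) x * f (contested (lower_player x))"
  by (simp add: expectation_round_contested[OF assms] higher_player_def lower_player_def)

lemma canonical_Suc_eq:
  assumes "total x > 0"
  shows "canonical q (Suc k) x =
    first_round_then
      (\<lambda>i. if i = higher_player x \<or> competes q k x then Strong else Weak)
      (\<lambda>r. canonical q k (update_reputation x r))"
proof -
  let ?s = "\<lambda>c. first_round_then (\<lambda>i. if i = higher_player x then Strong else c)
      (\<lambda>r. canonical q k (update_reputation x r))"
  let ?v = "\<lambda>c. utility q (lower_player x) (Suc k) x (?s c)"
  have "?v Strong > ?v Weak \<longleftrightarrow> competes q k x"
    unfolding utility_first_round_then expectation_round_uncontested
    using assms higher_neq_lower[of x]
    by (simp add: expectation_round_contested_higher_lower competes_def Let_def
        contested_def uncontested_def flip: contested_def uncontested_def)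
       (auto simp: contested_def uncontested_def)
  then show ?thesis
    by (simp add: Let_def cong: if_cong)
qed

declare canonical.simps(2) [simp del]

lemma canonical_value_Suc:
  assumes "total x > 0"
  shows "canonical_value q i (Suc k) x =
    (let h = higher_player x; l = lower_player x in
     if competes q k x
     then share h x * (payoff q (contested h i) + canonical_value q i k (promote h x)) +
          share l x * (payoff q (contested l i) + canonical_value q i k (promote l x))
     else payoff q (uncontested h i) + canonical_value q i k (promote h x))"
  unfolding canonical_Suc_eq[OF assms] utility_first_round_then
  using assms
  by (simp add: expectation_round_contested_higher_lower expectation_round_uncontested Let_def)

lemma share_higher: "total x > 0 \<Longrightarrow> share (higher_player x) x = 1 - share (lower_player x) x"
  using share_add[of x] by (auto simp: higher_player_def lower_player_def)

text \<open>Bellman equation. The player \<open>l\<close> is fixed by the current reputations and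
  may be the higher player after a win, so bounds proved by induction from it must treat an
  arbitrary player.\<close>

lemma lower_value_Suc:
  assumes "total x > 0"
  defines "l \<equiv> lower_player x" and "h \<equiv> higher_player x"
  shows "canonical_value q l (Suc k) x =
    max (q + canonical_value q l k (promote h x))
        (share l x * (1 + canonical_value q l k (promote l x)) +
         (1 - share l x) * canonical_value q l k (promote h x))"
  using higher_neq_lower[of x] share_higher[OF assms(1)]
  unfolding canonical_value_Suc[OF assms(1)] assms(2,3) Let_def
  by (simp add: contested_def uncontested_def competes_def Let_def)

lemma welfare_Suc:
  assumes "total x > 0"
  defines "l \<equiv> lower_player x" and "h \<equiv> higher_player x"
  shows "welfare q (Suc k) x =
    (if competes q k x
     then 1 + share l x * welfare q k (promote l x) + (1 - share l x) * welfare q k (promote h x)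
     else 1 + q + welfare q k (promote h x))"
proof -
  have "welfare q (Suc k) x = canonical_value q h (Suc k) x + canonical_value q l (Suc k) x"
    by (simp add: social_welfare_def l_def h_def lower_player_def higher_player_def)
  moreover have "welfare q k y = canonical_value q h k y + canonical_value q l k y" for y
    by (simp add: social_welfare_def l_def h_def lower_player_def higher_player_def)
  ultimately show ?thesis
    using higher_neq_lower[of x]
    unfolding canonical_value_Suc[OF assms(1)] assms(2,3) Let_def share_higher[OF assms(1)]
    by (simp add: contested_def uncontested_def) (simp add: algebra_simps)
qed

text \<open>Staying away always earns \<open>q\<close> and promotes only the higher player, so the
  roles persist and the option remains available.\<close>

lemma lower_value_ge:
  "total x > 0 \<Longrightarrow> real k * q \<le> canonical_value q (lower_player x) k x"
proof (induction k arbitrary: x)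
  case (Suc k)
  have "real k * q \<le> canonical_value q (lower_player x) k (promote (higher_player x) x)"
    using Suc.IH[of "promote (higher_player x) x"] by simp
  then show ?case
    by (simp add: lower_value_Suc[OF Suc.prems] algebra_simps)
qed simp

section \<open>Exponential tail bounds and the decision not to compete\<close>

text \<open>A supermartingale for a player's share \<open>z\<close> of the total reputation \<open>n\<close>: one contest
  multiplies \<open>exp (\<Lambda> z)\<close> by at most \<open>exp (\<Lambda>\<^sup>2 / (4 (n + 1)\<^sup>2))\<close> on average, and \<open>1 / (n + 1)\<^sup>2 \<le> 1 / n - 1 / (n + 1)\<close>.\<close>

definition chernoff :: "real \<Rightarrow> real \<Rightarrow> real \<Rightarrow> real \<Rightarrow> real" where
  "chernoff \<Lambda> r n z = exp (\<Lambda> * (z - r) + \<Lambda>\<^sup>2 / (4 * n))"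

lemma exp_le_quadratic:
  fixes t :: real
  assumes "t \<le> 1"
  shows "exp t \<le> 1 + t + t\<^sup>2"
proof (cases "t \<ge> 0")
  case True
  then show ?thesis using assms by (simp add: exp_bound)
next
  case False
  define u where "u = - t"
  have u: "u \<ge> 0" using False by (simp add: u_def)
  \<comment> \<open>The aim is \<open>1 \<le> (1 - u + u\<^sup>2) * exp u\<close>; the product with
    the quadratic Taylor polynomial of \<open>exp u\<close> has no negative terms.\<close>
  have "1 \<le> 1 + u\<^sup>2 / 2 + u ^ 3 / 2 + u ^ 4 / 2" using u by simp
  also have "\<dots> = (1 - u + u\<^sup>2) * (1 + u + u\<^sup>2 / 2)"
    by (simp add: power2_eq_square power3_eq_cube power4_eq_xxxx field_simps)
  also have "\<dots> \<le> (1 - u + u\<^sup>2) * exp u"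
  proof (rule mult_left_mono[OF exp_lower_Taylor_quadratic[OF u]])
    have "0 \<le> (1 - u)\<^sup>2 + u" using u by simp
    then show "0 \<le> 1 - u + u\<^sup>2" by (simp add: power2_eq_square algebra_simps)
  qed
  finally show ?thesis by (simp add: u_def exp_minus field_simps)
qed

lemma chernoff_supermartingale:
  assumes n: "n > 0" and L: "0 \<le> \<Lambda>" "\<Lambda> \<le> n + 1" and y: "0 \<le> y" "y \<le> n"
  shows "y / n * chernoff \<Lambda> r (n + 1) ((y + 1) / (n + 1)) +
    (1 - y / n) * chernoff \<Lambda> r (n + 1) (y / (n + 1)) \<le> chernoff \<Lambda> r n (y / n)"
proof -
  define z where "z = y / n"
  define s where "s = \<Lambda> / (n + 1)"
  have z: "0 \<le> z" "z \<le> 1" using n y by (auto simp: z_def)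
  have s: "0 \<le> s" "s \<le> 1" using n L by (auto simp: s_def)
  \<comment> \<open>Common factor of both successors: current share, next total. What remains is
    \<open>exp\<close> of \<open>\<Lambda>\<close> times the increment of the share, which is
    \<open>(1 - z) / (n + 1)\<close> or \<open>- z / (n + 1)\<close>.\<close>
  define C where "C = exp (\<Lambda> * (z - r) + \<Lambda>\<^sup>2 / (4 * (n + 1)))"
  have 1: "chernoff \<Lambda> r (n + 1) ((y + 1) / (n + 1)) = C * exp (s * (1 - z))"
    unfolding chernoff_def C_def s_def z_def exp_add[symmetric]
    by (rule arg_cong[of _ _ exp]) (use n in \<open>simp add: divide_simps, simp add: algebra_simps\<close>)
  have 2: "chernoff \<Lambda> r (n + 1) (y / (n + 1)) = C * exp (- s * z)"
    unfolding chernoff_def C_def s_def z_def exp_add[symmetric]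
    by (rule arg_cong[of _ _ exp]) (use n in \<open>simp add: divide_simps, simp add: algebra_simps\<close>)
  \<comment> \<open>The bound \<open>\<Lambda> \<le> n + 1\<close> keeps the positive exponent at
    most 1, as \<open>exp_le_quadratic\<close> requires.\<close>
  have sz: "0 \<le> s * z" "s * (1 - z) \<le> 1"
    using z s by (auto intro: mult_le_one)
  have "z * exp (s * (1 - z)) + (1 - z) * exp (- s * z)
      \<le> z * (1 + s * (1 - z) + (s * (1 - z))\<^sup>2) + (1 - z) * (1 + (- s * z) + (- s * z)\<^sup>2)"
    using z sz by (intro add_mono mult_left_mono exp_le_quadratic) auto
  also have "\<dots> = 1 + s\<^sup>2 * (z * (1 - z))"
    by (simp add: power2_eq_square algebra_simps)
  also have "\<dots> \<le> 1 + s\<^sup>2 * (1 / 4)"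
  proof -
    have "0 \<le> (z - 1 / 2)\<^sup>2" by simp
    then have "z * (1 - z) \<le> 1 / 4" by (simp add: power2_eq_square algebra_simps)
    then show ?thesis by (intro add_left_mono mult_left_mono) auto
  qed
  also have "\<dots> \<le> exp (s\<^sup>2 / 4)" using exp_ge_add_one_self[of "s\<^sup>2 / 4"] by simp
  finally have "C * (z * exp (s * (1 - z)) + (1 - z) * exp (- s * z)) \<le> C * exp (s\<^sup>2 / 4)"
    by (intro mult_left_mono) (auto simp: C_def)
  also have "C * exp (s\<^sup>2 / 4) \<le> chernoff \<Lambda> r n (y / n)"
  proof -
    have "s\<^sup>2 \<le> \<Lambda>\<^sup>2 / n - \<Lambda>\<^sup>2 / (n + 1)"
      using n unfolding s_def power2_eq_square
      by (simp add: divide_simps) (simp add: algebra_simps)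
    moreover have "\<Lambda>\<^sup>2 / (4 * n) = \<Lambda>\<^sup>2 / n / 4" by simp
    moreover have "\<Lambda>\<^sup>2 / (4 * (n + 1)) = \<Lambda>\<^sup>2 / (n + 1) / 4"
      unfolding divide_divide_eq_left by (simp add: mult.commute)
    moreover have "c / 4 + a / 4 \<le> b / 4" if "a \<le> b - c" for a b c :: real
      using that by simp
    ultimately have "\<Lambda>\<^sup>2 / (4 * (n + 1)) + s\<^sup>2 / 4 \<le> \<Lambda>\<^sup>2 / (4 * n)"
      by metis
    then show ?thesis
      unfolding chernoff_def C_def z_def exp_add[symmetric] exp_le_cancel_iff add.assoc
      by (rule add_left_mono)
  qed
  finally show ?thesis
    unfolding 1 2 z_def[symmetric] by (simp add: algebra_simps)
qed

lemma chernoff_promoted_other: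
  assumes "n > 0" "0 \<le> \<Lambda>" "0 \<le> y"
  shows "chernoff \<Lambda> r (n + 1) (y / (n + 1)) \<le> chernoff \<Lambda> r n (y / n)"
  unfolding chernoff_def using assms
  by (intro exp_le_cancel_iff[THEN iffD2] add_mono mult_left_mono diff_mono divide_left_mono) auto

text \<open>From share \<open>r\<close> on, \<open>chernoff\<close> is at least 1 and the trivial
  bound \<open>k \<le> K\<close> suffices. Below \<open>r \<le> 1 / 2\<close>, player
  \<open>i\<close> is the lower one, and either choice earns at most \<open>q\<close> now, since a
  contest earns the share on average; the supermartingale carries the remaining term. The fixed
  \<open>K\<close> keeps its coefficient constant in the induction.\<close>

lemma value_le_chernoff:
  assumes q: "0 < q" "q < 1" and r: "r \<le> q" "r \<le> 1 / 2"
    and L: "0 \<le> \<Lambda>"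
  shows "\<lbrakk>total x > 0; \<Lambda> \<le> real (total x) + 1; real k \<le> K\<rbrakk> \<Longrightarrow>
    canonical_value q i k x \<le> real k * q + K * chernoff \<Lambda> r (real (total x)) (share i x)"
proof (induction k arbitrary: x)
  case (Suc k)
  let ?n = "real (total x)"
  have K: "0 \<le> K" using Suc.prems by simp
  show ?case
  proof (cases "share i x \<ge> r")
    case True
    then have "1 \<le> chernoff \<Lambda> r ?n (share i x)"
      using L by (simp add: chernoff_def)
    then have "K * 1 \<le> K * chernoff \<Lambda> r ?n (share i x)"
      using K by (rule mult_left_mono)
    then show ?thesis
      using utility_le[of q i "Suc k" x "canonical q (Suc k) x"] q Suc.prems by (smt (verit) mult_nonneg_nonneg of_nat_0_le_iff)
  next
    case False
    then have "real (x i) / ?n < 1 / 2" using r unfolding share_def by linarith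
    then have "2 * real (x i) < ?n" using Suc.prems(1) by (simp add: divide_less_eq)
    then have "2 * x i < total x" by linarith
    then have i: "i = lower_player x" by (simp add: lower_player_eqI)
    let ?h = "higher_player x" and ?z = "share i x"
    let ?F = "\<lambda>y. canonical_value q i k y"
    let ?G = "\<lambda>y. chernoff \<Lambda> r (?n + 1) (share i y)"
    have IH: "?F (promote w x) \<le> real k * q + K * ?G (promote w x)" for w
      using Suc.IH[of "promote w x"] Suc.prems by (simp add: add.commute)
    have "?h \<noteq> i" using higher_neq_lower[of x] i by simp
    then have G: "?G (promote ?h x) = chernoff \<Lambda> r (?n + 1) (real (x i) / (?n + 1))"
       "?G (promote i x) = chernoff \<Lambda> r (?n + 1) ((real (x i) + 1) / (?n + 1))"
      by (simp_all add: share_promote_other share_promote_self)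
    have z: "0 \<le> ?z" "?z \<le> 1" "?z \<le> q" using share_nonneg share_le_1 False r by auto
    have n: "?n > 0" "real (x i) \<le> ?n" using Suc.prems \<open>2 * x i < total x\<close> by auto
    have "q + ?F (promote ?h x) \<le> q + (real k * q + K * ?G (promote ?h x))"
      using IH by simp
    also have "\<dots> \<le> real (Suc k) * q + K * chernoff \<Lambda> r ?n ?z"
      using mult_left_mono[OF chernoff_promoted_other[OF n(1) L, of "real (x i)" r] K]
      unfolding G by (simp add: share_def algebra_simps)
    finally have weak: "q + ?F (promote ?h x) \<le> real (Suc k) * q + K * chernoff \<Lambda> r ?n ?z" .
    have "?z * (1 + ?F (promote i x)) + (1 - ?z) * ?F (promote ?h x)
        \<le> ?z * (1 + (real k * q + K * ?G (promote i x))) +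
          (1 - ?z) * (real k * q + K * ?G (promote ?h x))"
      using z IH by (intro add_mono mult_left_mono order.refl) auto
    also have "\<dots> = ?z + real k * q + K * (?z * ?G (promote i x) + (1 - ?z) * ?G (promote ?h x))"
      by (simp add: algebra_simps)
    also have "\<dots> \<le> q + real k * q + K * chernoff \<Lambda> r ?n ?z"
      using z K n chernoff_supermartingale[of ?n \<Lambda> "real (x i)" r] L Suc.prems
      unfolding G by (intro add_mono mult_left_mono) (auto simp: share_def)
    finally have strong: "?z * (1 + ?F (promote i x)) + (1 - ?z) * ?F (promote ?h x)
        \<le> real (Suc k) * q + K * chernoff \<Lambda> r ?n ?z" by (simp add: algebra_simps)
    show ?thesis
      using lower_value_Suc[OF Suc.prems(1), of q k] weak strong unfolding i[symmetric] by simp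
  qed
qed (simp add: chernoff_def)


text \<open>Competing loses at least \<open>\<epsilon>\<close> now, since its expected payoff is at
  most \<open>r - \<epsilon>\<close> instead of \<open>q\<close>. By \<open>small\<close>, winning
  raises the later value by at most \<open>\<epsilon>\<close> over losing. A tie is enough for
  staying away.\<close>

lemma not_competes:
  assumes q: "0 < q" "q < 1" and r: "r \<le> q" "r \<le> 1 / 2"
    and L: "0 \<le> \<Lambda>" "\<Lambda> \<le> real (total x) + 2"
    and x: "total x > 0" "real k \<le> K"
    and z: "share (lower_player x) x \<le> r - \<epsilon>"
    and small: "K * chernoff \<Lambda> r (real (total x) + 1)
                  (share (lower_player x) (promote (lower_player x) x)) \<le> \<epsilon>"
  shows "\<not> competes q k x"
proof -
  let ?l = "lower_player x" and ?h = "higher_player x"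
  let ?p = "share ?l x"
  let ?A = "canonical_value q ?l k (promote ?l x)"
  let ?B = "canonical_value q ?l k (promote ?h x)"
  have "?A \<le> real k * q + \<epsilon>"
    using value_le_chernoff[OF q r L(1), of "promote ?l x" k K ?l] L x small
    by (simp add: add.commute)
  moreover have "real k * q \<le> ?B"
    using lower_value_ge[of "promote ?h x" k q] by simp
  ultimately have "?p * (1 + ?A) \<le> ?p * (1 + (?B + \<epsilon>))"
    by (intro mult_left_mono share_nonneg) simp
  moreover have "?p * \<epsilon> \<le> \<epsilon>"
  proof -
    have "0 \<le> K * chernoff \<Lambda> r (real (total x) + 1) (share ?l (promote ?l x))"
      using x by (auto simp: chernoff_def)
    then have "\<epsilon> \<ge> 0" using small by simp
    then show ?thesis using share_le_1 share_nonneg by (simp add: mult_left_le_one_le)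
  qed
  ultimately have "?p * (1 + ?A) + (1 - ?p) * ?B \<le> ?p + \<epsilon> + ?B"
    by (simp add: algebra_simps)
  then show ?thesis
    using z r x by (simp add: competes_def Let_def share_higher)
qed

text \<open>A win adds at most \<open>1 / m \<le> \<epsilon> / 2\<close> to the share, which stays
  \<open>\<epsilon> / 2\<close> below \<open>r\<close>. The choice
  \<open>\<Lambda> = \<epsilon> * m\<close> minimizes
  \<open>- \<Lambda> * \<epsilon> / 2 + \<Lambda>\<^sup>2 / (4 * m)\<close>, with minimum
  \<open>- \<epsilon>\<^sup>2 * m / 4 \<le> - 2 * ln K\<close>. Hence the excess value is at most
  \<open>K\<close> times \<open>1 / K\<^sup>2\<close>.\<close>

lemma not_competes_below:
  assumes q: "0 < q" "q < 1" and r: "r \<le> q" "r \<le> 1 / 2"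
    and \<epsilon>: "0 < \<epsilon>" "\<epsilon> \<le> 1" and K: "1 \<le> K * \<epsilon>"
    and m: "8 * ln K / \<epsilon>\<^sup>2 \<le> m" "2 / \<epsilon> \<le> m"
    and x: "m \<le> real (total x)" "real k \<le> K"
    and z: "share (lower_player x) x \<le> r - \<epsilon>"
  shows "\<not> competes q k x"
proof -
  let ?l = "lower_player x" and ?n = "real (total x)"
  let ?z = "share ?l (promote ?l x)"
  have "2 / \<epsilon> > 0" using \<epsilon> by simp
  then have m0: "m > 0" using m by linarith
  have n0: "?n > 0" using m0 x by linarith
  have K0: "K > 0" using K \<epsilon> by (smt (verit) mult_nonpos_nonneg)
  have em: "\<epsilon> * m \<le> m" using \<epsilon> m0 by simp
  have "?z \<le> (real (x ?l) + 1) / ?n"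
    unfolding share_promote_self using n0 by (intro divide_left_mono) auto
  also have "\<dots> = share ?l x + 1 / ?n" by (simp add: share_def add_divide_distrib)
  also have "1 / ?n \<le> 1 / m" using x m0 by (intro divide_left_mono) auto
  also have "1 / m \<le> \<epsilon> / 2" using m(2) m0 \<epsilon> by (simp add: field_simps)
  finally have z': "?z - r \<le> - \<epsilon> / 2" using z by simp
  have "(\<epsilon> * m) * (?z - r) \<le> (\<epsilon> * m) * (- \<epsilon> / 2)"
    using z' \<epsilon> m0 by (intro mult_left_mono) auto
  moreover have "(\<epsilon> * m)\<^sup>2 / (4 * (?n + 1)) \<le> (\<epsilon> * m)\<^sup>2 / (4 * m)"
    using x m0 by (intro divide_left_mono) auto
  moreover have "(\<epsilon> * m)\<^sup>2 / (4 * m) = \<epsilon>\<^sup>2 * m / 4"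
    using m0 by (simp add: power2_eq_square)
  moreover have "2 * ln K \<le> \<epsilon>\<^sup>2 * m / 4"
    using m(1) \<epsilon> by (simp add: field_simps)
  moreover have "(\<epsilon> * m) * (- \<epsilon> / 2) = - (\<epsilon>\<^sup>2 * m / 2)"
    by (simp add: power2_eq_square)
  ultimately have "(\<epsilon> * m) * (?z - r) + (\<epsilon> * m)\<^sup>2 / (4 * (?n + 1)) \<le> - 2 * ln K"
    by linarith
  then have "K * chernoff (\<epsilon> * m) r (?n + 1) ?z \<le> K * exp (- 2 * ln K)"
    unfolding chernoff_def using K0 by (intro mult_left_mono) auto
  also have "\<dots> = 1 / K"
  proof -
    have "exp (- 2 * ln K) = exp (- ln K) * exp (- ln K)" by (simp flip: exp_add)
    also have "\<dots> = inverse K * inverse K" using K0 by (simp add: exp_minus)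
    finally show ?thesis using K0 by (simp only:) (simp add: field_simps)
  qed
  also have "\<dots> \<le> \<epsilon>" using K K0 by (simp add: field_simps)
  finally show ?thesis
    using not_competes[OF q r, of "\<epsilon> * m" x k K \<epsilon>] \<epsilon> m0 em x n0 z by simp
qed

section \<open>Welfare bounds, in general and once competition has ceased\<close>

lemma welfare_ge:
  assumes "0 \<le> q"
  shows "total x > 0 \<Longrightarrow> real k \<le> welfare q k x"
proof (induction k arbitrary: x)
  case (Suc k)
  let ?l = "lower_player x" and ?h = "higher_player x" and ?p = "share (lower_player x) x"
  have IH: "real k \<le> welfare q k (promote w x)" for w using Suc.IH by simp
  have "?p * real k + (1 - ?p) * real k
      \<le> ?p * welfare q k (promote ?l x) + (1 - ?p) * welfare q k (promote ?h x)"
    using share_nonneg share_le_1 IH by (intro add_mono mult_left_mono) (auto simp: diff_ge_0_iff_ge)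
  then show ?case
    using IH[of ?h] assms by (simp add: welfare_Suc[OF Suc.prems] algebra_simps)
qed (simp add: social_welfare_def)

text \<open>The region is absorbing: without competition the higher player is promoted, so the total
  grows and the lower share does not.\<close>

lemma welfare_frozen:
  assumes no_comp: "\<And>j y. \<lbrakk>j \<le> K; m \<le> total y; share (lower_player y) y \<le> a\<rbrakk> \<Longrightarrow> \<not> competes q j y"
    and "m > 0"
  shows "\<lbrakk>k \<le> K; m \<le> total x; share (lower_player x) x \<le> a\<rbrakk> \<Longrightarrow> welfare q k x = real k * (1 + q)"
proof (induction k arbitrary: x)
  case (Suc k)
  let ?l = "lower_player x" and ?h = "higher_player x"
  have x: "total x > 0" using Suc.prems assms by simp
  have "share ?l (promote ?h x) \<le> share ?l x"
    using x higher_neq_lower[of x] unfolding share_promote_other[OF higher_neq_lower]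
    by (simp add: share_def divide_left_mono)
  then have "welfare q k (promote ?h x) = real k * (1 + q)"
    using Suc.prems by (intro Suc.IH) auto
  then show ?case
    using no_comp[of k x] Suc.prems by (simp add: welfare_Suc[OF x] algebra_simps)
qed (simp add: social_welfare_def)

section \<open>Comparison with a Polya urn\<close>

text \<open>In a Polya urn with \<open>n\<close> balls, \<open>i\<close> of them marked, this is the probability that the number
  of marked balls lies in \<open>A\<close> after \<open>d\<close> draws.\<close>

primrec urn :: "nat set \<Rightarrow> nat \<Rightarrow> nat \<Rightarrow> nat \<Rightarrow> real" where
  "urn A 0 i n = indicator A i"
| "urn A (Suc d) i n =
     real i / real n * urn A d (Suc i) (Suc n) + (1 - real i / real n) * urn A d i (Suc n)"

text \<open>If the number of marked balls is uniformly distributed on \<open>{1..<n}\<close> now, it is uniformly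
  distributed on \<open>{1..<n + d}\<close> after \<open>d\<close> draws.\<close>

lemma sum_urn:
  "n > 0 \<Longrightarrow>
   real (n + d - 1) * (\<Sum>i=1..<n. urn A d i n) = real (n - 1) * real (card (A \<inter> {1..<n + d}))"
proof (induction d arbitrary: n)
  case 0
  have "(\<Sum>i=1..<n. indicator A i :: real) = real (card (A \<inter> {1..<n}))"
    by (simp add: indicator_def sum.If_cases Int_commute flip: Int_def)
  then show ?case using 0 by simp
next
  case (Suc d)
  let ?g = "\<lambda>i. urn A d i (Suc n)"
  have "real n * (\<Sum>i=1..<n. urn A (Suc d) i n) =
      (\<Sum>i=1..<n. real i * ?g (Suc i)) + (\<Sum>i=1..<n. (real n - real i) * ?g i)"
    unfolding sum.distrib[symmetric] sum_distrib_left
    using Suc.prems by (intro sum.cong) (auto simp: field_simps)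
  \<comment> \<open>Both sums are brought to the range \<open>{1..<Suc n}\<close>; the terms added,
    at \<open>i = 1\<close> here and at \<open>i = n\<close> below, have coefficient 0.\<close>
  also have "(\<Sum>i=1..<n. real i * ?g (Suc i)) = (\<Sum>i=1..<Suc n. (real i - 1) * ?g i)"
  proof -
    have "(\<Sum>i=1..<Suc n. (real i - 1) * ?g i) = (\<Sum>i=0..<n. real i * ?g (Suc i))"
      using sum.shift_bounds_Suc_ivl[of "\<lambda>i. (real i - 1) * ?g i" 0 n] by simp
    also have "\<dots> = (\<Sum>i=1..<n. real i * ?g (Suc i))"
      using Suc.prems by (subst sum.atLeast_Suc_lessThan) auto
    finally show ?thesis ..
  qed
  also have "(\<Sum>i=1..<n. (real n - real i) * ?g i) = (\<Sum>i=1..<Suc n. (real n - real i) * ?g i)"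
    using Suc.prems by simp
  \<comment> \<open>The coefficients \<open>i - 1\<close> and \<open>n - i\<close> add up to
    \<open>n - 1\<close> for every \<open>i\<close>: this is how uniformity survives a draw.\<close>
  also have "(\<Sum>i=1..<Suc n. (real i - 1) * ?g i) + \<dots> = real (n - 1) * (\<Sum>i=1..<Suc n. ?g i)"
    unfolding sum.distrib[symmetric] sum_distrib_left
    using Suc.prems by (intro sum.cong) (auto simp: algebra_simps of_nat_diff)
  finally have "real n * (real (n + d) * (\<Sum>i=1..<n. urn A (Suc d) i n)) =
      real (n - 1) * (real (Suc n + d - 1) * (\<Sum>i=1..<Suc n. ?g i))"
    by simp
  also have "\<dots> = real n * (real (n - 1) * real (card (A \<inter> {1..<Suc n + d})))"
    using Suc.IH[of "Suc n"] by simp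
  finally show ?case using Suc.prems by simp
qed

text \<open>The event that the rarer colour has at most \<open>c\<close> of \<open>m\<close> balls.
  Being symmetric in the colours, it does not depend on which player is the lower one.\<close>

definition outer :: "nat \<Rightarrow> nat \<Rightarrow> nat set" where
  "outer c m = {i. i \<le> c \<or> m \<le> i + c}"

lemma urn_outer_symmetric:
  "\<lbrakk>n + d = m; 0 < n; i \<le> n\<rbrakk> \<Longrightarrow> urn (outer c m) d (n - i) n = urn (outer c m) d i n"
proof (induction d arbitrary: i n)
  case 0
  then have "n - i \<in> outer c m \<longleftrightarrow> i \<in> outer c m" by (auto simp: outer_def)
  then show ?case by (simp add: indicator_def)
next
  case (Suc d)
  have "urn (outer c m) d (Suc (n - i)) (Suc n) = urn (outer c m) d i (Suc n)"
    using Suc.IH[of "Suc n" i] Suc.prems by (simp add: Suc_diff_le)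
  moreover have "urn (outer c m) d (n - i) (Suc n) = urn (outer c m) d (Suc i) (Suc n)"
    using Suc.IH[of "Suc n" "Suc i"] Suc.prems by simp
  moreover have "real (n - i) / real n = 1 - real i / real n"
    using Suc.prems by (simp add: of_nat_diff diff_divide_distrib)
  ultimately show ?case by simp
qed

text \<open>A more balanced urn is less likely to end unbalanced. One draw from \<open>Suc i\<close>
  averages values at most \<open>?g (Suc i)\<close>, one draw from \<open>i\<close> averages values
  at least that. At the centre \<open>2 * i + 1 = n\<close> the induction hypothesis is out of
  reach, but symmetry gives equality.\<close>

lemma urn_outer_antimono:
  "\<lbrakk>n + d = m; 0 < n; 2 * i + 1 \<le> n\<rbrakk> \<Longrightarrow> urn (outer c m) d (Suc i) n \<le> urn (outer c m) d i n"
proof (induction d arbitrary: i n)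
  case 0
  then have "Suc i \<in> outer c m \<longrightarrow> i \<in> outer c m" by (auto simp: outer_def)
  then show ?case by (simp add: indicator_def)
next
  case (Suc d)
  show ?case
  proof (cases "2 * i + 1 = n")
    case True
    then have "n - i = Suc i" by simp
    then show ?thesis using urn_outer_symmetric[OF Suc.prems(1,2), of i c] True by simp
  next
    case False
    let ?g = "\<lambda>i. urn (outer c m) d i (Suc n)"
    have g: "?g (Suc (Suc i)) \<le> ?g (Suc i)" "?g (Suc i) \<le> ?g i"
      using Suc.IH[of "Suc n" "Suc i"] Suc.IH[of "Suc n" i] Suc.prems False by auto
    have "urn (outer c m) (Suc d) (Suc i) n \<le> ?g (Suc i)"
      unfolding urn.simps using g Suc.prems
      by (intro convex_bound_le) (auto simp: divide_le_eq_1)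
    also have "\<dots> \<le> urn (outer c m) (Suc d) i n"
    proof -
      have "real i / real n * ?g (Suc i) + (1 - real i / real n) * ?g (Suc i) \<le>
          urn (outer c m) (Suc d) i n"
        unfolding urn.simps using g Suc.prems
        by (intro add_mono mult_left_mono) (auto simp: divide_le_eq_1)
      then show ?thesis by (simp add: algebra_simps)
    qed
    finally show ?thesis .
  qed
qed

text \<open>A round without competition only lowers the share of the lower player, so the urn, which
  models permanent competition, is the worst case.\<close>

lemma welfare_ge_urn:
  assumes no_comp: "\<And>j y. \<lbrakk>j \<le> K; m \<le> total y; share (lower_player y) y \<le> a\<rbrakk> \<Longrightarrow> \<not> competes q j y"
    and q: "0 \<le> q" and c: "real c \<le> a * real m"
  shows "\<lbrakk>total x + d = m; 0 < total x; d \<le> k; k \<le> K\<rbrakk> \<Longrightarrow>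
    real k + q * (real k - real d) * urn (outer c m) d (x (lower_player x)) (total x)
      \<le> welfare q k x"
proof (induction d arbitrary: k x)
  case 0
  show ?case
  proof (cases "x (lower_player x) \<in> outer c m")
    case True
    \<comment> \<open>Whichever alternative of \<open>outer\<close> holds, the smaller of the two
      counts is at most \<open>c\<close>.\<close>
    then have "x (lower_player x) \<le> c"
      using lower_le_higher[of x] total_eq_higher_lower[of x] 0 by (auto simp: outer_def)
    then have "real (x (lower_player x)) \<le> a * real (total x)" using c 0 by simp
    then have "share (lower_player x) x \<le> a"
      using 0 by (simp add: share_def divide_le_eq)
    then have "welfare q k x = real k * (1 + q)"
      using 0 by (intro welfare_frozen[OF no_comp]) auto
    then show ?thesis using True by (simp add: algebra_simps)
  next
    case False
    then show ?thesis using welfare_ge[OF q] 0 by simp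
  qed
next
  case (Suc d)
  obtain k' where k: "k = Suc k'" using Suc.prems by (cases k) auto
  let ?l = "lower_player x" and ?h = "higher_player x" and ?n = "total x"
  let ?p = "share ?l x"
  define g where "g = (\<lambda>i. urn (outer c m) d i (Suc ?n))"
  have IH: "real k' + q * (real k' - real d) * g (promote w x ?l) \<le> welfare q k' (promote w x)" for w
  proof -
    let ?y = "promote w x"
    \<comment> \<open>The roles may swap after a win of \<open>?l\<close>; the lower count is then
      the complementary one, and the urn is symmetric.\<close>
    have "g (?y (lower_player ?y)) = g (?y ?l)"
    proof (cases "lower_player ?y = ?l")
      case False
      then have "?y ?l = total ?y - ?y (lower_player ?y)"
        by (cases "?l"; cases "lower_player ?y") (auto simp: total_def)
      moreover have "?y (lower_player ?y) \<le> Suc ?n"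
        using total_eq_higher_lower[of ?y] by simp
      ultimately show ?thesis
        using urn_outer_symmetric[of "Suc ?n" d m "?y (lower_player ?y)" c] Suc.prems
        by (simp add: g_def)
    qed simp
    then show ?thesis using Suc.IH[of ?y k'] Suc.prems by (simp add: g_def k)
  qed
  have hl: "promote ?h x ?l = x ?l" "promote ?l x ?l = Suc (x ?l)"
    using higher_neq_lower[of x] by (auto simp: promote_def)
  have urn: "urn (outer c m) (Suc d) (x ?l) ?n = ?p * g (Suc (x ?l)) + (1 - ?p) * g (x ?l)"
    by (simp add: g_def share_def)
  have p: "0 \<le> ?p" "?p \<le> 1" by (rule share_nonneg share_le_1)+
  have kd: "0 \<le> q * (real k' - real d)" using Suc.prems q k by simp
  show ?case
  proof (cases "competes q k' x")
    case True
    have "?p * (real k' + q * (real k' - real d) * g (Suc (x ?l))) +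
        (1 - ?p) * (real k' + q * (real k' - real d) * g (x ?l))
        \<le> ?p * welfare q k' (promote ?l x) + (1 - ?p) * welfare q k' (promote ?h x)"
      using p IH[of ?l] IH[of ?h] by (intro add_mono mult_left_mono) (simp_all add: hl)
    then show ?thesis
      using True unfolding urn k welfare_Suc[OF Suc.prems(2)] by (simp add: algebra_simps)
  next
    case False
    have "g (Suc (x ?l)) \<le> g (x ?l)"
      unfolding g_def using Suc.prems lower_le_higher[of x] total_eq_higher_lower[of x]
      by (intro urn_outer_antimono) auto
    then have "urn (outer c m) (Suc d) (x ?l) ?n \<le> g (x ?l)"
      unfolding urn using p by (intro convex_bound_le) auto
    then have "q * (real k' - real d) * urn (outer c m) (Suc d) (x ?l) ?n
        \<le> q * (real k' - real d) * g (x ?l)"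
      using kd by (rule mult_left_mono)
    then show ?thesis
      using False IH[of ?h] q unfolding k welfare_Suc[OF Suc.prems(2)] hl by (simp add: algebra_simps)
  qed
qed

lemma card_outer:
  assumes "2 * c < m"
  shows "card (outer c m \<inter> {1..<m}) = 2 * c"
proof -
  have "outer c m \<inter> {1..<m} = {1..<Suc c} \<union> {m - c..<m}"
    using assms by (auto simp: outer_def)
  moreover have "{1..<Suc c} \<inter> {m - c..<m} = {}" using assms by auto
  ultimately show ?thesis using assms by (simp add: card_Un_disjoint)
qed

text \<open>For \<open>n = 2\<close> the sum in \<open>sum_urn\<close> has the single term
  \<open>i = 1\<close>: one ball of each colour is already a uniform start.\<close>

lemma urn_outer_two_balls:
  assumes "2 \<le> m" "2 * c < m"
  shows "urn (outer c m) (m - 2) 1 2 = 2 * real c / real (m - 1)"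
proof -
  have "real (m - 1) * urn (outer c m) (m - 2) 1 2 = 2 * real c"
  proof -
    have "{1..<2} = {1::nat}" by auto
    moreover have "2 + (m - 2) = m" using assms(1) by simp
    ultimately show ?thesis
      using sum_urn[of 2 "m - 2" "outer c m"] card_outer[OF assms(2)] by simp
  qed
  then show ?thesis using assms by (simp add: field_simps)
qed

section \<open>Length of the initial phase\<close>

lemma pow4_le_exp:
  fixes x :: real
  assumes "0 \<le> x"
  shows "x ^ 4 / 256 \<le> exp x"
proof -
  have "(x / 4) ^ 4 \<le> exp (x / 4) ^ 4"
  proof (rule power_mono)
    show "x / 4 \<le> exp (x / 4)" using exp_ge_add_one_self[of "x / 4"] by linarith
  qed (use assms in simp)
  also have "\<dots> = exp x" by (simp flip: exp_of_nat_mult)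
  finally show ?thesis by (simp add: power_divide)
qed

text \<open>Applied with \<open>e = 1 / \<epsilon>\<close> and \<open>L = ln k\<close>, this makes
  the initial phase at most \<open>\<epsilon> * k\<close> rounds long. Since \<open>e\<close> and
  \<open>e\<^sup>2\<close> are at most \<open>L / 16\<close>, the left side is at most cubic in
  \<open>L\<close>, and \<open>L \<ge> 576\<close> lets \<open>L ^ 4 / 256\<close> dominate
  it.\<close>

lemma burn_in_le:
  fixes e L :: real
  assumes "6 \<le> e" "16 * e\<^sup>2 \<le> L"
  shows "e * (8 * L * e\<^sup>2 + 1) \<le> exp L"
proof -
  have e: "e \<le> e\<^sup>2" using assms by (simp add: power2_eq_square)
  have L: "576 \<le> L" using assms power_mono[of 6 e 2] by simp
  have "e * (8 * L * e\<^sup>2 + 1) = 8 * L * (e * e\<^sup>2) + e" by (simp add: algebra_simps)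
  also have "\<dots> \<le> 8 * L * ((L / 16) * (L / 16)) + L"
    using e assms L by (intro add_mono mult_left_mono mult_mono) auto
  also have "\<dots> \<le> L ^ 4 / 256"
  proof -
    have "8 * L * ((L / 16) * (L / 16)) = 8 * L ^ 3 / 256"
      by (simp add: power3_eq_cube)
    moreover have "L * 1 \<le> L * L\<^sup>2" using L one_le_power[of L 2] by (intro mult_left_mono) auto
    then have "L \<le> L ^ 3" by (simp add: power3_eq_cube power2_eq_square)
    moreover have "576 * L ^ 3 \<le> L * L ^ 3" using L by (intro mult_right_mono) auto
    moreover have "L * L ^ 3 = L ^ 4" by (simp add: eval_nat_numeral)
    ultimately show ?thesis using L by simp
  qed
  also have "\<dots> \<le> exp L" using L by (intro pow4_le_exp) auto
  finally show ?thesis .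
qed

section \<open>Choice of the parameters and collection of the errors\<close>

theorem theorem4p6:
  fixes q r \<epsilon> :: real and k :: nat
  assumes "0 < q" and "q < 1"
    and "r = min q (1 / 2)"
    and "\<epsilon> > 0"
    and "real k \<ge> exp (8 * (r - \<epsilon>) / \<epsilon> ^ 3) + exp (4 * ln (1 / 12) / ln (1 - r))"
  shows "performance_ratio q k 1 1 \<ge> (1 + 2 * q * (r - 3 * \<epsilon> - \<epsilon>\<^sup>2)) / (1 + q)"
proof -
  define x where "x = initial_reputation 1 1"
  have k_ge: "exp (8 * (r - \<epsilon>) / \<epsilon> ^ 3) \<le> real k"
    using assms(5) by (smt (verit) exp_gt_zero)
  then have k0: "real k > 0" by (smt (verit) exp_gt_zero)
  have x: "total x = 2" "x i = 1" for i
    by (cases i; simp add: x_def initial_reputation_def total_def)+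
  have "real k * (1 + 2 * q * (r - 3 * \<epsilon> - \<epsilon>\<^sup>2)) \<le> welfare q k x"
  proof (cases "r - 3 * \<epsilon> - \<epsilon>\<^sup>2 \<le> 0")
    case True
    \<comment> \<open>The claimed welfare is then at most \<open>k\<close>, which the stronger
      candidates alone provide.\<close>
    then have "2 * q * (r - 3 * \<epsilon> - \<epsilon>\<^sup>2) \<le> 0" using assms by (intro mult_nonneg_nonpos) auto
    then have "real k * (1 + 2 * q * (r - 3 * \<epsilon> - \<epsilon>\<^sup>2)) \<le> real k * 1"
      using k0 by (intro mult_left_mono) auto
    then show ?thesis using welfare_ge[of q x k] assms x by simp
  next
    case False
    have "\<epsilon>\<^sup>2 > 0" using assms by simp
    then have "3 * \<epsilon> < r" using False by linarith
    moreover have "r \<le> q" "r \<le> 1 / 2" using assms(3) by auto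
    ultimately have r: "3 * \<epsilon> < r" "r \<le> q" "r \<le> 1 / 2" .
    define L e where "L = ln (real k)" and "e = 1 / \<epsilon>"
    have e: "6 \<le> e" using r assms by (simp add: e_def field_simps)
    \<comment> \<open>Since \<open>r > 3 * \<epsilon>\<close>, the factor
      \<open>r - \<epsilon>\<close> in the bound on \<open>k\<close> exceeds
      \<open>2 * \<epsilon>\<close>.\<close>
    have "16 * e\<^sup>2 = 8 * (2 * \<epsilon>) / \<epsilon> ^ 3"
      using assms by (simp add: e_def power2_eq_square power3_eq_cube)
    also have "\<dots> \<le> 8 * (r - \<epsilon>) / \<epsilon> ^ 3"
      using r assms by (intro divide_right_mono) auto
    also have "\<dots> \<le> L" using k_ge k0 by (simp add: L_def ln_ge_iff)
    finally have L: "16 * e\<^sup>2 \<le> L" .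
    \<comment> \<open>\<open>m\<close> is the total reputation from which
      \<open>not_competes_below\<close> applies; \<open>c\<close> is the largest count whose share
      of \<open>m\<close> is at most \<open>r - \<epsilon>\<close>.\<close>
    define m where "m = nat \<lceil>8 * L * e\<^sup>2\<rceil>"
    define c where "c = nat \<lfloor>(r - \<epsilon>) * real m\<rfloor>"
    have "36 \<le> e\<^sup>2" using power_mono[of 6 e 2] e by simp
    then have L0: "L \<ge> 576" using L by simp
    then have m: "8 * L * e\<^sup>2 \<le> real m" "real m \<le> 8 * L * e\<^sup>2 + 1"
      by (simp_all add: m_def)
    have "e * real m \<le> exp L"
      using burn_in_le[OF e L] mult_left_mono[OF m(2), of e] e by linarith
    then have mk: "real m \<le> \<epsilon> * real k"
      using k0 assms by (simp add: L_def e_def field_simps)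
    have "2 * e \<le> 8 * L * e\<^sup>2"
    proof -
      have "2 * e \<le> 8 * e\<^sup>2" using e by (simp add: power2_eq_square)
      also have "\<dots> \<le> 8 * L * e\<^sup>2" using L0 by (intro mult_right_mono) auto
      finally show ?thesis .
    qed
    then have em: "2 * e \<le> real m" using m by simp
    then have m12: "12 \<le> real m" using e by simp
    have em': "1 \<le> \<epsilon> * real m" using em assms by (simp add: e_def field_simps)
    have "1 \<le> real k * \<epsilon>" using mk m12 by (simp add: mult.commute)
    then have no_comp: "\<not> competes q j y"
      if "j \<le> k" "m \<le> total y" "share (lower_player y) y \<le> r - \<epsilon>" for j y
      using that assms r m(1) em
      by (intro not_competes_below[of q r \<epsilon> "real k" "real m"]) (auto simp: L_def e_def power_divide)
    have c0: "0 \<le> (r - \<epsilon>) * real m" using r assms by simp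
    then have c: "real c \<le> (r - \<epsilon>) * real m" "(r - \<epsilon>) * real m - 1 \<le> real c"
      by (simp_all add: c_def)
    have "(r - \<epsilon>) * real m < 1 / 2 * real m" using r assms m12 by (intro mult_strict_right_mono) auto
    then have "2 * real c < real m" using c by simp
    then have cm: "2 * c < m" by linarith
    have "\<epsilon> * real k \<le> 1 * real k" using r by (intro mult_right_mono) auto
    then have km: "m \<le> k" using mk by simp
    \<comment> \<open>The total starts at 2, so it reaches \<open>m\<close> after
      \<open>m - 2\<close> rounds.\<close>
    have "real k + q * (real k - real (m - 2)) * urn (outer c m) (m - 2) 1 2 \<le> welfare q k x"
      using welfare_ge_urn[of k m "r - \<epsilon>" q c x "m - 2" k, OF no_comp] assms c(1) m12 km x by simp
    moreover have "2 * q * (real k * (r - 3 * \<epsilon> - \<epsilon>\<^sup>2))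
        \<le> q * (real k - real (m - 2)) * urn (outer c m) (m - 2) 1 2"
    proof -
      \<comment> \<open>The factor \<open>1 - \<epsilon>\<close> pays for the initial rounds. In
        \<open>r - 2 * \<epsilon>\<close>, one \<open>\<epsilon>\<close> is the margin below
        \<open>r\<close>, and the other absorbs the rounding of \<open>c\<close>, because
        \<open>1 \<le> \<epsilon> * m\<close>.\<close>
      have "r - 3 * \<epsilon> - \<epsilon>\<^sup>2 \<le> (1 - \<epsilon>) * (r - 2 * \<epsilon>)"
        using assms r by (simp add: power2_eq_square algebra_simps) (smt (verit) mult_left_le zero_le_mult_iff)
      then have "real k * (r - 3 * \<epsilon> - \<epsilon>\<^sup>2) \<le> (real k * (1 - \<epsilon>)) * (r - 2 * \<epsilon>)"
        using k0 by (simp add: mult.assoc)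
      also have "\<dots> \<le> (real k - real (m - 2)) * (real c / real (m - 1))"
      proof (intro mult_mono)
        show "real k * (1 - \<epsilon>) \<le> real k - real (m - 2)"
          using mk by (simp add: algebra_simps of_nat_diff)
        have "(r - 2 * \<epsilon>) * real m \<le> real c"
          using c(2) em' by (simp add: algebra_simps)
        then have "r - 2 * \<epsilon> \<le> real c / real m" using m12 by (simp add: pos_le_divide_eq)
        also have "\<dots> \<le> real c / real (m - 1)" using m12 by (intro divide_left_mono) auto
        finally show "r - 2 * \<epsilon> \<le> real c / real (m - 1)" .
      qed (use km r assms in auto)
      finally have "2 * q * (real k * (r - 3 * \<epsilon> - \<epsilon>\<^sup>2))
          \<le> 2 * q * ((real k - real (m - 2)) * (real c / real (m - 1)))"
        using assms by (intro mult_left_mono) auto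
      then show ?thesis
        using m12 cm by (subst urn_outer_two_balls) (auto simp: mult_ac)
    qed
    ultimately show ?thesis by (simp add: algebra_simps)
  qed
  then have "real k * (1 + 2 * q * (r - 3 * \<epsilon> - \<epsilon>\<^sup>2)) / (real k * (1 + q))
      \<le> welfare q k x / (real k * (1 + q))"
    using assms k0 by (intro divide_right_mono) auto
  then show ?thesis
    using k0 by (simp add: performance_ratio_def Let_def x_def)
qed

end
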